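(* Let $\Omega\subset\mathbb{R}^n$ be a convex domain and let $f\in C(\Omega)$ be non-negative. Let $u\in C(\Omega)$ be convex. (i) $u$ is a viscosity subsolution of $\det D^2u=f$ in $\Omega$ if and only if for every $x\in\Omega$ and every convex paraboloid $P$ that touches $u$ from above at $x$, $$P(x)\le\inf_{\substack{\det A=1\\ E_\varepsilon(A,x)\subset\Omega}}\left\{\frac{1}{|B_\varepsilon(0)|}\int_{B_\varepsilon(0)}P(x+Ay)\,dy\right\}-\frac{n}{2(n+2)}\,(f(x))^{1/n}\,\varepsilon^2+o(\varepsilon^2)\qquad\text{as }\varepsilon\to0.$$ (ii) $u$ is a viscosity supersolution of $\det D^2u=f$ in $\Omega$ if and only if for every $x\in\Omega$ and every convex paraboloid $P$ that touches $u$ from below at $x$, $$P(x)\ge\inf_{\substack{\det A=1\\ E_\varepsilon(A,x)\subset\Omega}}\left\{\frac{1}{|B_\varepsilon(0)|}\int_{B_\varepsilon(0)}P(x+Ay)\,dy\right\}-\frac{n}{2(n+2)}\,(f(x))^{1/n}\,\varepsilon^2+o(\varepsilon^2)\qquad\text{as }\varepsilon\to0.$$ The infima are over symmetric positive definite $n\times n$ real matrices $A$ satisfying the stated constraints.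
   Context: $B_\varepsilon(0)=\{y\in\mathbb{R}^n:|y|\le\varepsilon\}$. For a matrix $A$ with $\det A=1$, $x\in\mathbb{R}^n$ and $\varepsilon>0$, the ellipsoid $E_\varepsilon(A,x)$ is $$E_\varepsilon(A,x)=\{y\in\mathbb{R}^n:|A^{-1}(y-x)|\le\varepsilon\}=\{x+Ay:y\in B_\varepsilon(0)\}.$$ A paraboloid is a polynomial $P:\mathbb{R}^n\to\mathbb{R}$ of degree at most two, i.e. a $C^2$ function coinciding with its second-order Taylor expansion at any point; it is convex iff $D^2P\ge0$. $P$ touches $u$ from above (resp. below) at $x\in\Omega$ if $P(x)=u(x)$ and $P\ge u$ (resp. $P\le u$) in a neighborhood of $x$. A convex function $u$ is a viscosity subsolution (resp. supersolution) of $\det D^2u=f$ in $\Omega$ if for every $x_0\in\Omega$ and every convex paraboloid $P$ touching $u$ from above (resp. below) at $x_0$ one has $\det D^2P(x_0)\ge f(x_0)$ (resp. $\det D^2P(x_0)\le f(x_0)$). For a constant $c$ and a real function $g$: "$c\le g(\varepsilon)+o(\varepsilon^2)$ as $\varepsilon\to0$" means $\lim_{\varepsilon\to0}[c-g(\varepsilon)]^+/\varepsilon^2=0$, and "$c\ge g(\varepsilon)+o(\varepsilon^2)$ as $\varepsilon\to0$" means $\lim_{\varepsilon\to0}[c-g(\varepsilon)]^-/\varepsilon^2=0$, where $[\cdot]^\pm$ denote positive and negative parts. *)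

theory Defs
  imports "HOL-Analysis.Analysis"
begin

definition symmetric_pos_def :: "real^'n^'n \<Rightarrow> bool" where
  "symmetric_pos_def A \<longleftrightarrow> transpose A = A \<and> (\<forall>v. v \<noteq> 0 \<longrightarrow> 0 < v \<bullet> (A *v v))"

definition ellipsoid :: "real^'n^'n \<Rightarrow> real^'n \<Rightarrow> real \<Rightarrow> (real^'n) set" where
  "ellipsoid A x \<epsilon> = {y. norm (matrix_inv A *v (y - x)) \<le> \<epsilon>}"

(* The general polynomial of degree at most two; Q need not be symmetric, and the
   second derivative is Q + transpose Q. *)
definition paraboloid :: "(real^'n \<Rightarrow> real) \<Rightarrow> bool" where
  "paraboloid P \<longleftrightarrow> (\<exists>c b Q. \<forall>y. P y = c + b \<bullet> y + y \<bullet> (Q *v y))"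

definition convex_paraboloid :: "(real^'n \<Rightarrow> real) \<Rightarrow> bool" where
  "convex_paraboloid P \<longleftrightarrow> paraboloid P \<and> convex_on UNIV P"

definition hessian :: "(real^'n \<Rightarrow> real) \<Rightarrow> real^'n \<Rightarrow> real^'n^'n" where
  "hessian g x =
    (\<chi> i j. frechet_derivative (\<lambda>y. frechet_derivative g (at y) (axis j 1)) (at x) (axis i 1))"

(* The neighbourhood of x is not tied to a domain: touching is only considered at
   points of an open set on which u is defined. *)
definition touches_above :: "(real^'n \<Rightarrow> real) \<Rightarrow> (real^'n \<Rightarrow> real) \<Rightarrow> real^'n \<Rightarrow> bool" where
  "touches_above P u x \<longleftrightarrow> P x = u x \<and> (\<forall>\<^sub>F y in nhds x. u y \<le> P y)"

definition touches_below :: "(real^'n \<Rightarrow> real) \<Rightarrow> (real^'n \<Rightarrow> real) \<Rightarrow> real^'n \<Rightarrow> bool" where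
  "touches_below P u x \<longleftrightarrow> P x = u x \<and> (\<forall>\<^sub>F y in nhds x. P y \<le> u y)"

definition MA_viscosity_subsolution ::
    "(real^'n) set \<Rightarrow> (real^'n \<Rightarrow> real) \<Rightarrow> (real^'n \<Rightarrow> real) \<Rightarrow> bool" where
  "MA_viscosity_subsolution \<Omega> f u \<longleftrightarrow> convex_on \<Omega> u \<and>
    (\<forall>x\<in>\<Omega>. \<forall>P. convex_paraboloid P \<and> touches_above P u x \<longrightarrow> det (hessian P x) \<ge> f x)"

definition MA_viscosity_supersolution ::
    "(real^'n) set \<Rightarrow> (real^'n \<Rightarrow> real) \<Rightarrow> (real^'n \<Rightarrow> real) \<Rightarrow> bool" where
  "MA_viscosity_supersolution \<Omega> f u \<longleftrightarrow> convex_on \<Omega> u \<and>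
    (\<forall>x\<in>\<Omega>. \<forall>P. convex_paraboloid P \<and> touches_below P u x \<longrightarrow> det (hessian P x) \<le> f x)"

definition ball_average :: "(real^'n \<Rightarrow> real) \<Rightarrow> real^'n \<Rightarrow> real^'n^'n \<Rightarrow> real \<Rightarrow> real" where
  "ball_average P x A \<epsilon> =
    (1 / measure lborel (cball (0::real^'n) \<epsilon>)) * (LINT y:cball 0 \<epsilon>|lborel. P (x + A *v y))"

(* The infimum is taken in the reals. For P convex the averages are bounded below by P x,
   and for x in an open set and small positive \<epsilon> the identity matrix is admissible, so it
   is then the genuine infimum of a nonempty set that is bounded below. *)
definition inf_average :: "(real^'n) set \<Rightarrow> (real^'n \<Rightarrow> real) \<Rightarrow> real^'n \<Rightarrow> real \<Rightarrow> real" where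
  "inf_average \<Omega> P x \<epsilon> =
    (INF A\<in>{A. symmetric_pos_def A \<and> det A = 1 \<and> ellipsoid A x \<epsilon> \<subseteq> \<Omega>}. ball_average P x A \<epsilon>)"

(* c \<le> g \<epsilon> + o(\<epsilon>^2) and c \<ge> g \<epsilon> + o(\<epsilon>^2) as \<epsilon> tends to 0 through positive values, with
   the positive and negative parts of c - g \<epsilon> written as maxima. *)
definition le_plus_o_sq :: "real \<Rightarrow> (real \<Rightarrow> real) \<Rightarrow> bool" where
  "le_plus_o_sq c g \<longleftrightarrow> ((\<lambda>\<epsilon>. max 0 (c - g \<epsilon>) / \<epsilon>\<^sup>2) \<longlongrightarrow> 0) (at_right 0)"

definition ge_plus_o_sq :: "real \<Rightarrow> (real \<Rightarrow> real) \<Rightarrow> bool" where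
  "ge_plus_o_sq c g \<longleftrightarrow> ((\<lambda>\<epsilon>. max 0 (- (c - g \<epsilon>)) / \<epsilon>\<^sup>2) \<longlongrightarrow> 0) (at_right 0)"

end

theory Submission
  imports Defs
begin

text \<open>
  Write \<open>H\<close> for the Hessian of \<open>P\<close>. Expanding \<open>P\<close> at \<open>x\<close> and integrating over the ball, the linear
  term vanishes by symmetry and the quadratic one leaves only the trace, so the average of
  \<open>P (x + A y)\<close> is exactly \<open>P x + tr (A\<^sup>T H A) \<epsilon>\<^sup>2 / (2 (n + 2))\<close>. By the arithmetic-geometric mean
  inequality the infimum of the trace over positive definite \<open>A\<close> with determinant 1 is
  \<open>n (det H)\<^sup>1\<^sup>/\<^sup>n\<close>, and any fixed \<open>A\<close> is admissible once \<open>\<epsilon>\<close> is small. Hence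
  \<open>(inf_average - P x) / \<epsilon>\<^sup>2\<close> tends to \<open>n (det H)\<^sup>1\<^sup>/\<^sup>n / (2 (n + 2))\<close>, and for each single
  \<open>P\<close> and \<open>x\<close> the asymptotic inequality is equivalent to the comparison of \<open>det H\<close> with \<open>f x\<close>.
\<close>

subsection \<open>Diagonalization of symmetric matrices\<close>

lemma symmetric_matrix_dot:
  fixes A :: "real^'n^'n"
  assumes "transpose A = A"
  shows "x \<bullet> (A *v y) = (A *v x) \<bullet> y"
  by (metis assms dot_lmul_matrix transpose_matrix_vector)

lemma quadratic_form_congruence:
  fixes A H :: "real^'n^'n"
  shows "x \<bullet> ((transpose A ** H ** A) *v x) = (A *v x) \<bullet> (H *v (A *v x))"
proof -
  have "x \<bullet> ((transpose A ** H ** A) *v x) = x \<bullet> (transpose A *v (H *v (A *v x)))"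
    by (simp add: matrix_vector_mul_assoc matrix_mul_assoc)
  also have "\<dots> = (A *v x) \<bullet> (H *v (A *v x))"
    by (metis dot_lmul_matrix vector_transpose_matrix)
  finally show ?thesis .
qed

text \<open>For small \<open>t\<close> the linear term dominates the quadratic one, so a small
  \<open>t\<close> of sign opposite to \<open>a\<close> would make the sum negative.\<close>

lemma linear_term_eq_0_if_nonneg:
  fixes a q :: real
  assumes "\<And>t. 0 \<le> t * a + t\<^sup>2 * q"
  shows "a = 0"
proof (rule ccontr)
  assume "a \<noteq> 0"
  \<comment> \<open>At \<open>t = - s * a\<close> the linear term gains
    \<open>s * a\<^sup>2\<close>; this \<open>s\<close> is small enough that the quadratic term, at
    most \<open>s * \<bar>q\<bar>\<close> times that gain, cannot compensate.\<close>
  define s where "s = 1 / (2 * (\<bar>q\<bar> + 1))"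
  have s: "s > 0" "s * \<bar>q\<bar> < 1"
    by (auto simp: s_def field_simps)
  have "0 \<le> (- s * a) * a + (- s * a)\<^sup>2 * q"
    by (rule assms)
  also have "\<dots> = s * a\<^sup>2 * (s * q - 1)"
    by (simp add: power2_eq_square algebra_simps)
  finally have "0 \<le> s * a\<^sup>2 * (s * q - 1)" .
  moreover have "0 < s * a\<^sup>2"
    using s \<open>a \<noteq> 0\<close> by simp
  ultimately have "0 \<le> s * q - 1"
    by (metis zero_le_mult_iff not_less)
  moreover have "s * q \<le> s * \<bar>q\<bar>"
    using s by (simp add: mult_left_mono)
  ultimately show False using s by linarith
qed

text \<open>The eigenvector is a maximiser of the Rayleigh quotient on \<open>S\<close>: the first variation of the
  nonnegative form \<open>y \<mapsto> c \<bar>y\<bar>\<^sup>2 - y \<bullet> A y\<close> vanishes there.\<close>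
lemma symmetric_matrix_eigenvector_in_subspace:
  fixes A :: "real^'n^'n"
  assumes sym: "transpose A = A" and S: "subspace S" and inv: "\<And>y. y \<in> S \<Longrightarrow> A *v y \<in> S"
    and "z \<in> S" "z \<noteq> 0"
  obtains x c where "x \<in> S" "norm x = 1" "A *v x = c *\<^sub>R x"
proof -
  let ?K = "sphere 0 1 \<inter> S"
  have "compact ?K"
    using S by (simp add: closed_subspace compact_Int_closed)
  moreover have "z /\<^sub>R norm z \<in> ?K"
    using assms by (simp add: subspace_scale)
  moreover have "continuous_on ?K (\<lambda>y. y \<bullet> (A *v y))"
    by (intro continuous_intros matrix_vector_mult_linear_continuous_on)
  ultimately obtain x where x: "x \<in> ?K" and max: "\<And>y. y \<in> ?K \<Longrightarrow> y \<bullet> (A *v y) \<le> x \<bullet> (A *v x)"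
    using continuous_attains_sup[of ?K "\<lambda>y. y \<bullet> (A *v y)"] by blast
  define c where "c = x \<bullet> (A *v x)"
  have le: "y \<bullet> (A *v y) \<le> c * (norm y)\<^sup>2" if "y \<in> S" for y
  proof (cases "y = 0")
    case False
    then have "y /\<^sub>R norm y \<in> ?K"
      using that S by (simp add: subspace_scale)
    then have "(y /\<^sub>R norm y) \<bullet> (A *v (y /\<^sub>R norm y)) \<le> c"
      unfolding c_def by (rule max)
    then show ?thesis
      using False by (simp add: matrix_vector_mult_scaleR field_simps power2_eq_square)
  qed auto
  \<comment> \<open>\<open>w\<close> is the residual of the eigenvector equation and half the
    gradient at \<open>x\<close> of the nonnegative form
    \<open>c * (norm y)\<^sup>2 - y \<bullet> (A *v y)\<close>. Invariance of \<open>S\<close> keeps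
    \<open>w\<close> in \<open>S\<close>, so \<open>x\<close> may be varied in this direction; the
    linear coefficient is then \<open>2 * (w \<bullet> w)\<close>.\<close>
  define w where "w = c *\<^sub>R x - A *v x"
  have wS: "w \<in> S"
    using x S inv by (auto simp: w_def intro: subspace_diff subspace_scale)
  have "0 \<le> t * (2 * (w \<bullet> w)) + t\<^sup>2 * (c * (norm w)\<^sup>2 - w \<bullet> (A *v w))" for t
  proof -
    have "(x + t *\<^sub>R w) \<bullet> (A *v (x + t *\<^sub>R w)) \<le> c * (norm (x + t *\<^sub>R w))\<^sup>2"
      using x wS S by (intro le) (auto intro: subspace_add subspace_scale)
    moreover have "(x + t *\<^sub>R w) \<bullet> (A *v (x + t *\<^sub>R w))
        = c + 2 * t * (w \<bullet> (A *v x)) + t\<^sup>2 * (w \<bullet> (A *v w))"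
    proof -
      have "x \<bullet> (A *v w) = w \<bullet> (A *v x)"
        using symmetric_matrix_dot[OF sym, of x w] by (simp add: inner_commute)
      then show ?thesis
        by (simp add: c_def matrix_vector_right_distrib matrix_vector_mult_scaleR inner_add_left
            inner_add_right power2_eq_square algebra_simps)
    qed
    moreover have "(norm (x + t *\<^sub>R w))\<^sup>2 = 1 + 2 * t * (w \<bullet> x) + t\<^sup>2 * (norm w)\<^sup>2"
      using x unfolding power2_norm_eq_inner
      by (simp add: inner_add_left inner_add_right inner_commute power2_eq_square algebra_simps norm_eq_1)
    ultimately have "c + 2 * t * (w \<bullet> (A *v x)) + t\<^sup>2 * (w \<bullet> (A *v w))
        \<le> c * (1 + 2 * t * (w \<bullet> x) + t\<^sup>2 * (norm w)\<^sup>2)"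
      by simp
    moreover have "w \<bullet> w = c * (w \<bullet> x) - w \<bullet> (A *v x)"
      by (subst (2) w_def) (simp add: inner_diff_right)
    ultimately show ?thesis
      by (simp only:) (simp add: algebra_simps)
  qed
  then have "2 * (w \<bullet> w) = 0"
    by (rule linear_term_eq_0_if_nonneg)
  then have "A *v x = c *\<^sub>R x"
    by (simp add: w_def)
  with x show thesis by (intro that) auto
qed

text \<open>The orthogonal complement of the eigenvectors found so far is invariant because
  \<open>A\<close> is symmetric, and it is nonzero as long as there are fewer than
  \<open>CARD('n)\<close> of them. It therefore contains a further unit eigenvector.\<close>

lemma symmetric_matrix_orthonormal_eigenvectors:
  fixes A :: "real^'n^'n"
  assumes sym: "transpose A = A" and "k \<le> CARD('n)"
  shows "\<exists>B. finite B \<and> card B = k \<and> pairwise orthogonal B \<and>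
    (\<forall>x\<in>B. norm x = 1 \<and> (\<exists>c. A *v x = c *\<^sub>R x))"
  using \<open>k \<le> CARD('n)\<close>
proof (induction k)
  case 0
  show ?case by (rule exI[of _ "{}"]) auto
next
  case (Suc k)
  then obtain B where B: "finite B" "card B = k" "pairwise orthogonal B"
    and eig: "\<And>x. x \<in> B \<Longrightarrow> norm x = 1 \<and> (\<exists>c. A *v x = c *\<^sub>R x)"
    by auto
  let ?S = "{y. \<forall>x\<in>B. orthogonal x y}"
  have "dim (span B) < DIM(real^'n)"
    using dim_le_card'[of B] B Suc.prems by simp
  then obtain z where z: "z \<noteq> 0" "\<And>y. y \<in> span B \<Longrightarrow> orthogonal z y"
    by (metis dim_span orthogonal_to_subspace_exists)
  then have "z \<in> ?S"
    by (auto simp: span_base orthogonal_commute)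
  moreover have "subspace ?S"
    by (auto simp: subspace_def orthogonal_clauses)
  moreover have "A *v y \<in> ?S" if "y \<in> ?S" for y
  proof -
    have "x \<bullet> (A *v y) = 0" if "x \<in> B" for x
      using eig[OF that] \<open>y \<in> ?S\<close> that
      by (auto simp: symmetric_matrix_dot[OF sym] orthogonal_def)
    then show ?thesis by (simp add: orthogonal_def)
  qed
  ultimately obtain x c where x: "x \<in> ?S" "norm x = 1" "A *v x = c *\<^sub>R x"
    using symmetric_matrix_eigenvector_in_subspace[OF sym, of ?S z] z(1) by blast
  have "x \<notin> B"
    using x by (auto simp: orthogonal_def)
  moreover have "pairwise orthogonal (insert x B)"
    using B x by (auto simp: pairwise_insert orthogonal_commute)
  ultimately show ?case
    using B eig x by (intro exI[of _ "insert x B"]) auto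
qed

definition diag_mat :: "('n \<Rightarrow> real) \<Rightarrow> real^'n^'n" where
  "diag_mat d = (\<chi> i j. if i = j then d i else 0)"

lemma diag_mat_nth [simp]: "diag_mat d $ i $ j = (if i = j then d i else 0)"
  by (simp add: diag_mat_def)

lemma transpose_diag_mat [simp]: "transpose (diag_mat d) = diag_mat d"
  by (simp add: vec_eq_iff transpose_def)

lemma det_diag_mat [simp]: "det (diag_mat d) = (\<Prod>i\<in>UNIV. d i)"
  by (subst det_diagonal) auto

lemma trace_diag_mat [simp]: "trace (diag_mat d) = (\<Sum>i\<in>UNIV. d i)"
  by (simp add: trace_def)

lemma diag_mat_mult: "diag_mat d ** diag_mat e = diag_mat (\<lambda>i. d i * e i)"
  by (simp add: vec_eq_iff matrix_matrix_mult_def if_distrib[of "\<lambda>x. x * _"] cong: if_cong)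

lemma diag_mat_dot: "x \<bullet> (diag_mat d *v x) = (\<Sum>i\<in>UNIV. d i * (x $ i)\<^sup>2)"
  by (simp add: inner_vec_def matrix_vector_mult_def if_distrib[of "\<lambda>x. x * _"] power2_eq_square
      mult.left_commute cong: if_cong)

theorem symmetric_matrix_diagonalization:
  fixes A :: "real^'n^'n"
  assumes sym: "transpose A = A"
  obtains U d where "orthogonal_matrix U" "A = U ** diag_mat d ** transpose U"
proof -
  obtain B where B: "finite B" "card B = CARD('n)" "pairwise orthogonal B"
    and eig: "\<forall>x\<in>B. norm x = 1 \<and> (\<exists>c. A *v x = c *\<^sub>R x)"
    using symmetric_matrix_orthonormal_eigenvectors[OF sym order_refl] by blast
  \<comment> \<open>Indexing the eigenvectors by the index type itself allows them to serve as the
    columns of a square matrix.\<close>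
  obtain f where f: "bij_betw f (UNIV::'n set) B"
    using finite_same_card_bij[of "UNIV::'n set" B] B by auto
  have fB: "f i \<in> B" for i
    using f by (auto simp: bij_betw_def)
  have "\<exists>c. A *v f i = c *\<^sub>R f i" for i
    using eig fB[of i] by blast
  then obtain d where d: "\<And>i. A *v f i = d i *\<^sub>R f i"
    by metis
  define U where "U = (\<chi> i j. f j $ i)"
  have U: "orthogonal_matrix U"
    unfolding orthogonal_matrix_orthonormal_columns
  proof (intro conjI allI impI)
    show "norm (column i U) = 1" for i
      using eig fB by (simp add: U_def column_def)
    show "orthogonal (column i U) (column j U)" if "i \<noteq> j" for i j
    proof -
      have "f i \<noteq> f j"
        using f that by (auto simp: bij_betw_def inj_on_def)
      then show ?thesis
        using B fB by (auto simp: U_def column_def pairwise_def)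
    qed
  qed
  have "(A ** U) $ i $ j = (U ** diag_mat d) $ i $ j" for i j
  proof -
    have "(A ** U) $ i $ j = (A *v f j) $ i"
      by (simp add: matrix_matrix_mult_def matrix_vector_mult_def U_def)
    also have "\<dots> = (U ** diag_mat d) $ i $ j"
      by (simp add: d matrix_matrix_mult_def U_def if_distrib[of "\<lambda>x. _ * x"] cong: if_cong)
    finally show ?thesis .
  qed
  then have "A ** U = U ** diag_mat d"
    by (simp add: vec_eq_iff)
  then have "A = U ** diag_mat d ** transpose U"
    using U by (metis matrix_mul_assoc matrix_mul_rid orthogonal_matrix_def)
  with U show thesis by (rule that)
qed

lemma
  fixes U :: "real^'n^'n"
  assumes "orthogonal_matrix U"
  shows trace_orthogonal_conj: "trace (U ** M ** transpose U) = trace M"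
    and det_orthogonal_conj: "det (U ** M ** transpose U) = det M"
proof -
  have U: "transpose U ** U = mat 1"
    using assms by (simp add: orthogonal_matrix_def)
  show "trace (U ** M ** transpose U) = trace M"
    by (metis U matrix_mul_assoc matrix_mul_lid trace_mul_sym)
  have "det U * det U = 1"
    by (metis U det_I det_mul det_transpose)
  then show "det (U ** M ** transpose U) = det M"
    by (simp add: det_mul)
qed

lemma psd_matrix_diagonalization:
  fixes A :: "real^'n^'n"
  assumes "transpose A = A" and psd: "\<And>v. 0 \<le> v \<bullet> (A *v v)"
  obtains U d where "orthogonal_matrix U" "A = U ** diag_mat d ** transpose U" "\<And>i. 0 \<le> d i"
proof -
  obtain U d where U: "orthogonal_matrix U" and A: "A = U ** diag_mat d ** transpose U"
    using symmetric_matrix_diagonalization[OF assms(1)] by blast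
  have "transpose U ** A ** U = diag_mat d"
    using U A by (metis matrix_mul_assoc matrix_mul_lid matrix_mul_rid orthogonal_matrix_def)
  \<comment> \<open>The \<open>i\<close>-th eigenvalue is the value of the quadratic form of
    \<open>A\<close> at the \<open>i\<close>-th column of \<open>U\<close>, hence
    nonnegative.\<close>
  then have "d i = axis i 1 \<bullet> ((transpose U ** A ** U) *v axis i 1)" for i
    by (simp add: diag_mat_dot axis_def if_distrib[of "\<lambda>x. _ * x\<^sup>2"] cong: if_cong)
  then have "0 \<le> d i" for i
    by (simp only: quadratic_form_congruence psd)
  with U A show thesis by (rule that)
qed

subsection \<open>The infimum of the trace over unimodular congruences\<close>

text \<open>After diagonalization trace and determinant are the sum and the product of nonnegative
  eigenvalues, so this is the arithmetic-geometric mean inequality.\<close>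

lemma root_det_le_trace:
  fixes B :: "real^'n^'n"
  assumes "transpose B = B" and "\<And>v. 0 \<le> v \<bullet> (B *v v)"
  shows "real CARD('n) * root CARD('n) (det B) \<le> trace B"
proof -
  obtain U d where U: "orthogonal_matrix U" and B: "B = U ** diag_mat d ** transpose U"
    and d: "\<And>i. 0 \<le> d i"
    using psd_matrix_diagonalization[OF assms] by blast
  have "(\<Prod>i\<in>UNIV. d i) powr (1 / CARD('n)) \<le> (\<Sum>i\<in>UNIV. d i / CARD('n))"
    by (rule arith_geom_mean) (auto simp: d)
  moreover have "root CARD('n) (\<Prod>i\<in>UNIV. d i) = (\<Prod>i\<in>UNIV. d i) powr (1 / CARD('n))"
    using d by (subst root_powr_inverse) (auto simp: prod_nonneg)
  ultimately show ?thesis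
    unfolding B trace_orthogonal_conj[OF U] det_orthogonal_conj[OF U]
    by (simp add: sum_divide_distrib[symmetric] field_simps)
qed

lemma root_det_le_trace_congruence:
  fixes A H :: "real^'n^'n"
  assumes "transpose H = H" "\<And>v. 0 \<le> v \<bullet> (H *v v)" "det A = 1"
  shows "real CARD('n) * root CARD('n) (det H) \<le> trace (transpose A ** H ** A)"
proof -
  have "det (transpose A ** H ** A) = det H"
    by (simp add: det_mul assms(3))
  moreover have "real CARD('n) * root CARD('n) (det (transpose A ** H ** A))
      \<le> trace (transpose A ** H ** A)"
    using assms(1,2)
    by (intro root_det_le_trace) (simp_all add: matrix_transpose_mul matrix_mul_assoc
        quadratic_form_congruence del: matrix_vector_mul_assoc)
  ultimately show ?thesis by simp
qed

text \<open>Where \<open>H\<close> is singular the infimum of the trace need not be attained, so the minimiser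
  is taken for \<open>H + \<delta> I\<close>.\<close>
lemma exists_trace_congruence_less:
  fixes H :: "real^'n^'n"
  assumes "transpose H = H" "\<And>v. 0 \<le> v \<bullet> (H *v v)" "e > 0"
  obtains A where "symmetric_pos_def A" "det A = 1"
    "trace (transpose A ** H ** A) < real CARD('n) * root CARD('n) (det H) + e"
proof -
  let ?n = "CARD('n)"
  obtain U d where U: "orthogonal_matrix U" and H: "H = U ** diag_mat d ** transpose U"
    and d: "\<And>i. 0 \<le> d i"
    using psd_matrix_diagonalization[OF assms(1,2)] by blast
  \<comment> \<open>\<open>g \<delta>\<close> is the geometric mean of the eigenvalues of the
    regularized matrix. Its continuity at 0 lets the regularization cost less than
    \<open>e\<close>.\<close>
  define g where "g \<delta> = root ?n (\<Prod>i\<in>UNIV. d i + \<delta>)" for \<delta>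
  have "((\<lambda>\<delta>. real ?n * g \<delta>) \<longlongrightarrow> real ?n * g 0) (at_right 0)"
    unfolding g_def by (intro tendsto_intros)
  then have "\<forall>\<^sub>F \<delta> in at_right 0. real ?n * g \<delta> < real ?n * g 0 + e"
    by (rule order_tendstoD) (use assms(3) in auto)
  then have "\<forall>\<^sub>F \<delta> in at_right 0. \<delta> > 0 \<and> real ?n * g \<delta> < real ?n * g 0 + e"
    by (intro eventually_conj) (auto simp: eventually_at_right_less)
  then obtain \<delta> where \<delta>: "\<delta> > 0" "real ?n * g \<delta> < real ?n * g 0 + e"
    using eventually_happens'[OF trivial_limit_at_right_real] by blast
  have pos: "d i + \<delta> > 0" for i
    using d[of i] \<delta> by simp
  have gpos: "g \<delta> > 0"
    using pos by (auto simp: g_def prod_pos)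
  \<comment> \<open>This is the equality case of the mean inequality:
    \<open>(a i)\<^sup>2 * (d i + \<delta>)\<close> equals \<open>g \<delta>\<close> for every
    \<open>i\<close>, and the choice of \<open>g \<delta>\<close> makes the product of the
    \<open>a i\<close> equal to 1.\<close>
  define a where "a i = sqrt (g \<delta> / (d i + \<delta>))" for i
  have apos: "a i > 0" for i
    using pos gpos by (simp add: a_def)
  define A where "A = U ** diag_mat a ** transpose U"
  have symA: "transpose A = A"
    by (simp add: A_def matrix_transpose_mul matrix_mul_assoc)
  have "0 < v \<bullet> (A *v v)" if "v \<noteq> 0" for v
  proof -
    let ?w = "transpose U *v v"
    have "A = transpose (transpose U) ** diag_mat a ** transpose U"
      by (simp add: A_def)
    then have "v \<bullet> (A *v v) = (\<Sum>i\<in>UNIV. a i * (?w $ i)\<^sup>2)"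
      by (simp only: quadratic_form_congruence diag_mat_dot)
    moreover have "?w \<noteq> 0"
      using U that
      by (metis matrix_vector_mul_assoc matrix_vector_mul_lid matrix_vector_mult_0_right orthogonal_matrix_def)
    then obtain i where "?w $ i \<noteq> 0"
      by (auto simp: vec_eq_iff)
    then have "(\<Sum>i\<in>UNIV. a i * (?w $ i)\<^sup>2) > 0"
      by (intro sum_pos2[of _ i]) (auto simp: apos less_imp_le)
    ultimately show ?thesis by simp
  qed
  then have "symmetric_pos_def A"
    using symA by (simp add: symmetric_pos_def_def)
  moreover have "det A = 1"
  proof -
    have "(\<Prod>i\<in>UNIV. g \<delta> / (d i + \<delta>)) = g \<delta> ^ ?n / (\<Prod>i\<in>UNIV. d i + \<delta>)"
      by (simp add: prod_dividef)
    also have "g \<delta> ^ ?n = (\<Prod>i\<in>UNIV. d i + \<delta>)"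
      unfolding g_def using pos by (intro real_root_pow_pos2) (auto intro: prod_nonneg less_imp_le)
    finally have "(\<Prod>i\<in>UNIV. g \<delta> / (d i + \<delta>)) = 1"
      using pos by (simp add: prod_zero_iff) (metis less_irrefl)
    moreover have "(\<Prod>i\<in>UNIV. g \<delta> / (d i + \<delta>)) = (\<Prod>i\<in>UNIV. a i)\<^sup>2"
      unfolding prod_power_distrib
      using pos gpos by (intro prod.cong) (auto simp: a_def less_imp_le)
    moreover have "(\<Prod>i\<in>UNIV. a i) > 0"
      using apos by (simp add: prod_pos)
    ultimately have "(\<Prod>i\<in>UNIV. a i) = 1"
      by (simp add: power2_eq_1_iff)
    then show ?thesis
      by (simp add: A_def det_orthogonal_conj[OF U])
  qed
  moreover have "trace (transpose A ** H ** A) < real ?n * root ?n (det H) + e"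
  proof -
    have UU: "transpose U ** U = mat 1"
      using U by (simp add: orthogonal_matrix_def)
    have "transpose A ** H ** A
        = U ** diag_mat a ** (transpose U ** U) ** diag_mat d ** (transpose U ** U) ** diag_mat a ** transpose U"
      unfolding symA by (simp only: A_def H matrix_mul_assoc)
    also have "\<dots> = U ** (diag_mat a ** diag_mat d ** diag_mat a) ** transpose U"
      by (simp add: UU matrix_mul_assoc)
    finally have "trace (transpose A ** H ** A) = (\<Sum>i\<in>UNIV. a i * d i * a i)"
      by (simp add: trace_orthogonal_conj[OF U] diag_mat_mult)
    \<comment> \<open>Returning from the regularized eigenvalues \<open>d i + \<delta>\<close> to
      \<open>d i\<close> can only decrease each diagonal entry below the common value
      \<open>g \<delta>\<close>.\<close>
    also have "\<dots> \<le> (\<Sum>i\<in>(UNIV::'n set). g \<delta>)"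
    proof (rule sum_mono)
      fix i
      have "a i * d i * a i = (a i)\<^sup>2 * d i"
        by (simp add: power2_eq_square)
      also have "\<dots> = g \<delta> / (d i + \<delta>) * d i"
        using pos[of i] gpos by (simp add: a_def)
      also have "\<dots> \<le> g \<delta>"
        using pos[of i] gpos \<delta>(1) by (simp add: field_simps)
      finally show "a i * d i * a i \<le> g \<delta>" .
    qed
    also have "\<dots> < real ?n * g 0 + e"
      using \<delta> by simp
    also have "g 0 = root ?n (det H)"
      by (simp add: g_def H det_orthogonal_conj[OF U])
    finally show ?thesis .
  qed
  ultimately show thesis by (rule that)
qed

subsection \<open>Second moments of a ball\<close>

lemma set_integrable_cball:
  fixes f :: "'a::euclidean_space \<Rightarrow> real"
  assumes "continuous_on UNIV f"
  shows "set_integrable lborel (cball c r) f"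
  unfolding set_integrable_def
  using assms by (intro borel_integrable_compact) (auto intro: continuous_on_subset)

section \<open>Invariance of ball integrals under sign changes and permutations of
  coordinates\<close>

lemma distr_lborel_sign_change:
  fixes s :: "'n::finite \<Rightarrow> real"
  assumes "\<And>i. \<bar>s i\<bar> = 1"
  shows "distr lborel borel (\<lambda>y::real^'n. \<chi> i. s i * y $ i) = lborel"
proof -
  \<comment> \<open>\<open>lborel_affine_euclidean\<close> expects scale factors indexed by basis
    vectors; \<open>?c\<close> carries \<open>s\<close> over to them, with value \<open>s i\<close>
    at \<open>axis i 1\<close>. The resulting density is 1 because all factors have modulus
    1.\<close>
  let ?c = "\<lambda>b::real^'n. \<Sum>i\<in>UNIV. s i * b $ i"
  have c: "?c (axis i 1) = s i" for i
    by (simp add: axis_def if_distrib[of "\<lambda>x. _ * x"] cong: if_cong)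
  have "0 + (\<Sum>j\<in>Basis. (?c j * (y \<bullet> j)) *\<^sub>R j) = (\<chi> i. s i * y $ i)" for y :: "real^'n"
  proof -
    have "(\<chi> i. s i * y $ i) \<bullet> j = ?c j * (y \<bullet> j)" if "j \<in> Basis" for j
      using that c by (auto simp: Basis_vec_def inner_axis)
    then have "(\<Sum>j\<in>Basis. (?c j * (y \<bullet> j)) *\<^sub>R j)
        = (\<Sum>j\<in>Basis. ((\<chi> i. s i * y $ i) \<bullet> j) *\<^sub>R j)"
      by (intro sum.cong) auto
    then show ?thesis
      by (simp add: euclidean_representation)
  qed
  moreover have "\<bar>?c j\<bar> = 1" if "j \<in> Basis" for j
    using that c assms by (auto simp: Basis_vec_def)
  moreover from this have "?c j \<noteq> 0" if "j \<in> Basis" for j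
    using that by fastforce
  ultimately show ?thesis
    using lborel_affine_euclidean[of ?c 0] by (simp add: density_1)
qed

text \<open>\<open>lborel\<close> is determined by its values on boxes, and permuting the
  coordinates only permutes the side lengths of a box.\<close>

lemma distr_lborel_permute:
  fixes p :: "'n::finite \<Rightarrow> 'n"
  assumes "bij p"
  shows "distr lborel borel (\<lambda>y::real^'n. \<chi> i. y $ p i) = lborel"
proof (rule lborel_eqI[symmetric])
  fix l u :: "real^'n"
  assume le: "\<And>b. b \<in> Basis \<Longrightarrow> l \<bullet> b \<le> u \<bullet> b"
  let ?T = "\<lambda>y::real^'n. \<chi> i. y $ p i" and ?q = "inv p"
  have T [measurable]: "?T \<in> borel \<rightarrow>\<^sub>M borel"
    by (intro borel_measurable_continuous_onI continuous_intros)
  have le': "l $ i \<le> u $ i" for i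
    using le[of "axis i 1"] by (auto simp: Basis_vec_def inner_axis)
  have q: "bij ?q" "\<And>i. p (?q i) = i" "\<And>i. ?q (p i) = i"
    using assms by (auto simp: bij_imp_bij_inv bij_is_surj bij_is_inj surj_f_inv_f)
  have prod_Basis: "(\<Prod>b\<in>Basis. f b) = (\<Prod>i\<in>UNIV. f (axis i 1))" for f :: "real^'n \<Rightarrow> real"
  proof -
    have "inj (\<lambda>i::'n. axis i (1::real))"
      by (auto simp: inj_on_def axis_eq_axis)
    moreover have Basis: "(Basis :: (real^'n) set) = range (\<lambda>i. axis i 1)"
      by (auto simp: Basis_vec_def)
    ultimately show ?thesis
      unfolding Basis by (simp add: prod.reindex)
  qed
  have "?T -` box l u = box (\<chi> i. l $ ?q i) (\<chi> i. u $ ?q i)"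
    using q by (auto simp: mem_box_cart) metis+
  moreover have "emeasure lborel (box (\<chi> i. l $ ?q i) (\<chi> i. u $ ?q i))
      = (\<Prod>b\<in>Basis. ((\<chi> i. u $ ?q i) - (\<chi> i. l $ ?q i)) \<bullet> (b::real^'n))"
    using le' by (intro emeasure_lborel_box) (auto simp: Basis_vec_def inner_axis)
  moreover have "(\<Prod>b\<in>Basis. ((\<chi> i. u $ ?q i) - (\<chi> i. l $ ?q i)) \<bullet> (b::real^'n))
      = (\<Prod>i\<in>UNIV. u $ ?q i - l $ ?q i)"
    by (simp add: prod_Basis inner_axis)
  moreover have "\<dots> = (\<Prod>i\<in>UNIV. u $ i - l $ i)"
    using prod.reindex_bij_betw[OF q(1), of "\<lambda>i. u $ i - l $ i"] by simp
  moreover have "\<dots> = (\<Prod>b\<in>Basis. (u - l) \<bullet> b)"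
    by (simp add: prod_Basis inner_axis)
  ultimately show "emeasure (distr lborel borel ?T) (box l u) = (\<Prod>b\<in>Basis. (u - l) \<bullet> b)"
    by (simp add: emeasure_distr)
qed simp

text \<open>In the change of variables \<open>T\<close> leaves the measure fixed by the first
  assumption, and the indicator of the centred ball fixed because norms are preserved.\<close>

lemma set_integral_cball_isometry:
  fixes f :: "'a::euclidean_space \<Rightarrow> real" and T :: "'a \<Rightarrow> 'a"
  assumes T: "distr lborel borel T = lborel" "T \<in> borel \<rightarrow>\<^sub>M borel" "\<And>y. norm (T y) = norm y"
    and f: "f \<in> borel_measurable borel"
  shows "(LINT y:cball 0 r|lborel. f (T y)) = (LINT y:cball 0 r|lborel. f y)"
proof -
  have "(LINT y:cball 0 r|lborel. f y)
      = (\<integral>y. indicator (cball 0 r) y *\<^sub>R f y \<partial>distr lborel borel T)"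
    unfolding T(1) set_lebesgue_integral_def ..
  also have "\<dots> = (\<integral>y. indicator (cball 0 r) (T y) *\<^sub>R f (T y) \<partial>lborel)"
    using T(2) f by (intro integral_distr borel_measurable_scaleR borel_measurable_indicator) auto
  also have "\<dots> = (LINT y:cball 0 r|lborel. f (T y))"
    unfolding set_lebesgue_integral_def
    by (intro Bochner_Integration.integral_cong) (auto simp: indicator_def T(3))
  finally show ?thesis ..
qed

lemma norm_sign_change:
  fixes y :: "real^'n"
  assumes "\<And>i. \<bar>s i\<bar> = (1::real)"
  shows "norm (\<chi> i. s i * y $ i) = norm y"
  using assms by (simp add: norm_vec_def abs_mult)

lemma norm_permute:
  fixes y :: "real^'n" and p :: "'n \<Rightarrow> 'n"
  assumes "bij p"
  shows "norm (\<chi> i. y $ p i) = norm y"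
  unfolding norm_vec_def L2_set_def
  using sum.reindex_bij_betw[OF assms, of "\<lambda>i. (norm (y $ i))\<^sup>2"] by simp

lemma set_integral_cball_sign_change:
  fixes f :: "real^'n \<Rightarrow> real"
  assumes "continuous_on UNIV f" "\<And>i. \<bar>s i\<bar> = (1::real)"
  shows "(LINT y:cball 0 r|lborel. f (\<chi> i. s i * y $ i)) = (LINT y:cball 0 r|lborel. f y)"
  using assms by (intro set_integral_cball_isometry[where T = "\<lambda>y. \<chi> i. s i * y $ i"])
    (auto intro!: borel_measurable_continuous_onI continuous_intros
      simp: distr_lborel_sign_change norm_sign_change)

lemma set_integral_cball_permute:
  fixes f :: "real^'n \<Rightarrow> real" and p :: "'n \<Rightarrow> 'n"
  assumes "continuous_on UNIV f" "bij p"
  shows "(LINT y:cball 0 r|lborel. f (\<chi> i. y $ p i)) = (LINT y:cball 0 r|lborel. f y)"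
  using assms by (intro set_integral_cball_isometry[where T = "\<lambda>y. \<chi> i. y $ p i"])
    (auto intro!: borel_measurable_continuous_onI continuous_intros
      simp: distr_lborel_permute norm_permute)

text \<open>The reflection of \<open>y\<close> to \<open>- y\<close> turns the integral into its own
  negative.\<close>

lemma cball_integral_linear:
  fixes g :: "real^'n"
  shows "(LINT y:cball 0 r|lborel. g \<bullet> y) = 0"
proof -
  have "(LINT y:cball 0 r|lborel. g \<bullet> (\<chi> i. (-1) * y $ i)) = (LINT y:cball 0 r|lborel. g \<bullet> y)"
    by (rule set_integral_cball_sign_change) (auto intro: continuous_intros)
  moreover have "g \<bullet> (\<chi> i. (-1) * y $ i) = - (g \<bullet> y)" for y
    by (simp add: inner_vec_def sum_negf)
  ultimately show ?thesis
    by (simp add: set_lebesgue_integral_def)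
qed

text \<open>Flipping the sign of coordinate \<open>i\<close> alone reverses the sign of the
  integrand, since \<open>j\<close> differs from \<open>i\<close>.\<close>

lemma cball_integral_product_offdiag:
  fixes i j :: "'n::finite"
  assumes "i \<noteq> j"
  shows "(LINT y:cball (0::real^'n) r|lborel. y $ i * y $ j) = 0"
proof -
  let ?s = "\<lambda>k. if k = i then -1 else (1::real)"
  have "(LINT y:cball (0::real^'n) r|lborel. (\<chi> k. ?s k * y $ k) $ i * (\<chi> k. ?s k * y $ k) $ j)
      = (LINT y:cball (0::real^'n) r|lborel. y $ i * y $ j)"
    by (rule set_integral_cball_sign_change[where f = "\<lambda>y. y $ i * y $ j"])
      (auto intro!: continuous_intros)
  then show ?thesis
    using assms by (simp add: set_lebesgue_integral_def)
qed

lemma cball_integral_square_eq: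
  fixes i j :: "'n::finite"
  shows "(LINT y:cball (0::real^'n) r|lborel. (y $ i)\<^sup>2) = (LINT y:cball (0::real^'n) r|lborel. (y $ j)\<^sup>2)"
  using set_integral_cball_permute[of "\<lambda>y::real^'n. (y $ i)\<^sup>2" "Transposition.transpose i j" r]
  by (simp add: continuous_intros)

text \<open>Substituting \<open>r *\<^sub>R y\<close> for the variable, the volume element
  contributes \<open>r ^ DIM('a)\<close> and the integrand \<open>r\<^sup>2\<close>.\<close>

lemma cball_integral_norm_sq_scale:
  assumes "r > 0"
  shows "(LINT y:cball (0::'a::euclidean_space) r|lborel. (norm y)\<^sup>2)
    = r ^ (DIM('a) + 2) * (LINT y:cball (0::'a) 1|lborel. (norm y)\<^sup>2)"
proof -
  let ?T = "\<lambda>x::'a. 0 + r *\<^sub>R x"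
  let ?f = "\<lambda>y::'a. indicator (cball 0 r) y *\<^sub>R (norm y)\<^sup>2"
  have [measurable]: "cball (0::'a) r \<in> sets borel"
    by simp
  have [measurable]: "?T \<in> borel \<rightarrow>\<^sub>M borel" "?f \<in> borel_measurable borel"
    by measurable
  have "(LINT y:cball (0::'a) r|lborel. (norm y)\<^sup>2)
      = integral\<^sup>L (density (distr lborel borel ?T) (\<lambda>_. ennreal (r ^ DIM('a)))) ?f"
    unfolding set_lebesgue_integral_def
    using lborel_affine[of r "0::'a"] assms by (simp add: ennreal_power)
  also have "\<dots> = (\<integral>y. r ^ DIM('a) *\<^sub>R ?f (?T y) \<partial>lborel)"
    using assms by (simp add: integral_density integral_distr)
  also have "\<dots> = (\<integral>y. r ^ (DIM('a) + 2) * (indicator (cball 0 1) y *\<^sub>R (norm y)\<^sup>2) \<partial>(lborel::'a measure))"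
    using assms by (intro Bochner_Integration.integral_cong)
      (auto simp: indicator_def power_mult_distrib power_add power2_eq_square)
  finally show ?thesis
    by (simp add: set_lebesgue_integral_def)
qed

text \<open>Both the volume and the second moment are homogeneous in the radius; comparing them on the
  thin shell \<open>1 \<le> \<bar>y\<bar> \<le> r\<close> and letting \<open>r \<rightarrow> 1\<close> relates their constants.\<close>
lemma cball_integral_norm_sq:
  assumes "r > 0"
  shows "(LINT y:cball (0::'a::euclidean_space) r|lborel. (norm y)\<^sup>2)
    = DIM('a) / (DIM('a) + 2) * r\<^sup>2 * measure lborel (cball (0::'a) r)"
proof -
  let ?n = "DIM('a)" and ?\<omega> = "unit_ball_vol DIM('a)"
  define M where "M r = (LINT y:cball (0::'a) r|lborel. (norm y)\<^sup>2)" for r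
  define V where "V r = (LINT y:cball (0::'a) r|lborel. (1::real))" for r
  have V: "V r = ?\<omega> * r ^ ?n" if "r \<ge> 0" for r
    using content_cball[of r "0::'a"] that by (simp add: V_def set_lebesgue_integral_def)
  have M: "M r = r ^ (?n + 2) * M 1" if "r > 0" for r
    unfolding M_def using that by (rule cball_integral_norm_sq_scale)
  have int: "set_integrable lborel (cball (0::'a) r) f" if "continuous_on UNIV f" for f :: "'a \<Rightarrow> real" and r
    using that by (rule set_integrable_cball)
  \<comment> \<open>On the shell the integrand \<open>(norm y)\<^sup>2\<close> lies between 1 and
    \<open>r\<^sup>2\<close>, while the shell itself has volume \<open>V r - V 1\<close>.\<close>
  have lower: "V r - V 1 \<le> M r - M 1" and upper: "M r - M 1 \<le> r\<^sup>2 * (V r - V 1)" if "r > 1" for r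
  proof -
    let ?D = "cball (0::'a) r - cball 0 1"
    have diff: "(LINT y:cball (0::'a) r|lborel. f y) - (LINT y:cball (0::'a) 1|lborel. f y)
        = (LINT y:?D|lborel. f y)" and intD: "set_integrable lborel ?D f"
      if "continuous_on UNIV f" for f :: "'a \<Rightarrow> real"
    proof -
      show i: "set_integrable lborel ?D f"
        using int[OF that, of r] by (rule set_integrable_subset) auto
      have "(LINT y:?D \<union> cball 0 1|lborel. f y)
          = (LINT y:?D|lborel. f y) + (LINT y:cball 0 1|lborel. f y)"
        using i int[OF that] by (intro set_integral_Un) auto
      moreover have "?D \<union> cball 0 1 = cball 0 r"
        using \<open>r > 1\<close> by auto
      ultimately show "(LINT y:cball (0::'a) r|lborel. f y) - (LINT y:cball (0::'a) 1|lborel. f y)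
        = (LINT y:?D|lborel. f y)" by simp
    qed
    have "(LINT y:?D|lborel. (1::real)) \<le> (LINT y:?D|lborel. (norm y)\<^sup>2)"
      by (intro set_integral_mono intD continuous_intros) auto
    then show "V r - V 1 \<le> M r - M 1"
      unfolding V_def M_def by (subst (1 2) diff) (auto intro!: continuous_intros)
    have "(LINT y:?D|lborel. (norm y)\<^sup>2) \<le> (LINT y:?D|lborel. r\<^sup>2 * 1)"
      by (intro set_integral_mono intD continuous_intros) (auto intro: power_mono)
    then show "M r - M 1 \<le> r\<^sup>2 * (V r - V 1)"
      unfolding V_def M_def set_integral_mult_right[symmetric] right_diff_distrib
      by (subst (1 2) diff) (auto intro!: continuous_intros)
  qed
  \<comment> \<open>Dividing the shell estimates by \<open>r - 1\<close> produces difference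
    quotients of powers of \<open>r\<close> at 1; the factors \<open>?n\<close> and
    \<open>?n + 2\<close> are their limits.\<close>
  have lim: "((\<lambda>r::real. (r ^ k - 1) / (r - 1)) \<longlongrightarrow> real k) (at_right 1)" for k
  proof -
    have "((\<lambda>r::real. r ^ k) has_field_derivative real k) (at 1 within {1<..})"
      by (auto intro!: derivative_eq_intros)
    then show ?thesis
      by (simp add: has_field_derivative_iff)
  qed
  have ev: "\<forall>\<^sub>F r::real in at_right 1. r > 1"
    by (simp add: eventually_at_right_less)
  have "real ?n * ?\<omega> \<le> real (?n + 2) * M 1"
  proof (rule tendsto_le[OF trivial_limit_at_right_real])
    show "((\<lambda>r. (r ^ ?n - 1) / (r - 1) * ?\<omega>) \<longlongrightarrow> real ?n * ?\<omega>) (at_right 1)"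
      by (intro tendsto_intros lim)
    show "((\<lambda>r. (r ^ (?n + 2) - 1) / (r - 1) * M 1) \<longlongrightarrow> real (?n + 2) * M 1) (at_right 1)"
      by (intro tendsto_intros lim)
    show "\<forall>\<^sub>F r in at_right 1. (r ^ ?n - 1) / (r - 1) * ?\<omega> \<le> (r ^ (?n + 2) - 1) / (r - 1) * M 1"
      using ev
    proof eventually_elim
      case (elim r)
      have "(r ^ ?n - 1) * ?\<omega> \<le> (r ^ (?n + 2) - 1) * M 1"
        using lower[OF elim] V[of r] V[of 1] M[of r] elim by (simp add: algebra_simps)
      then show ?case
        using elim by (simp add: divide_right_mono)
    qed
  qed
  moreover have "real (?n + 2) * M 1 \<le> 1\<^sup>2 * (real ?n * ?\<omega>)"
  proof (rule tendsto_le[OF trivial_limit_at_right_real])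
    show "((\<lambda>r. r\<^sup>2 * ((r ^ ?n - 1) / (r - 1) * ?\<omega>)) \<longlongrightarrow> 1\<^sup>2 * (real ?n * ?\<omega>)) (at_right 1)"
      by (intro tendsto_intros lim)
    show "((\<lambda>r. (r ^ (?n + 2) - 1) / (r - 1) * M 1) \<longlongrightarrow> real (?n + 2) * M 1) (at_right 1)"
      by (intro tendsto_intros lim)
    show "\<forall>\<^sub>F r in at_right 1. (r ^ (?n + 2) - 1) / (r - 1) * M 1
        \<le> r\<^sup>2 * ((r ^ ?n - 1) / (r - 1) * ?\<omega>)"
      using ev
    proof eventually_elim
      case (elim r)
      have "(r ^ (?n + 2) - 1) * M 1 \<le> r\<^sup>2 * ((r ^ ?n - 1) * ?\<omega>)"
        using upper[OF elim] V[of r] V[of 1] M[of r] elim by (simp add: algebra_simps)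
      then have "(r ^ (?n + 2) - 1) * M 1 / (r - 1) \<le> r\<^sup>2 * ((r ^ ?n - 1) * ?\<omega>) / (r - 1)"
        using elim by (intro divide_right_mono) auto
      then show ?case
        by simp
    qed
  qed
  ultimately have "M 1 = real ?n / (real ?n + 2) * ?\<omega>"
    by (simp add: field_simps)
  then have "M r = real ?n / (real ?n + 2) * r\<^sup>2 * (?\<omega> * r ^ ?n)"
    using M[OF assms] by (simp add: power_add power2_eq_square)
  then show ?thesis
    using content_cball[of r "0::'a"] assms by (simp add: M_def)
qed

text \<open>By symmetry all coordinates have the same second moment, and together they add up to the
  integral of \<open>(norm y)\<^sup>2\<close>, so each is its \<open>CARD('n)\<close>-th
  part.\<close>

lemma cball_integral_square:
  fixes i :: "'n::finite"
  assumes "r > 0"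
  shows "(LINT y:cball (0::real^'n) r|lborel. (y $ i)\<^sup>2)
    = r\<^sup>2 / (real CARD('n) + 2) * measure lborel (cball (0::real^'n) r)" (is "?K i = _")
proof -
  have "(LINT y:cball (0::real^'n) r|lborel. (norm y)\<^sup>2)
      = (LINT y:cball (0::real^'n) r|lborel. \<Sum>i\<in>UNIV. (y $ i)\<^sup>2)"
    by (simp only: power2_norm_eq_inner inner_vec_def) (simp add: power2_eq_square)
  also have "\<dots> = (\<Sum>i\<in>UNIV. ?K i)"
    unfolding set_lebesgue_integral_def scaleR_sum_right
    by (intro Bochner_Integration.integral_sum
        set_integrable_cball[unfolded set_integrable_def] continuous_intros)
  also have "\<dots> = (\<Sum>j\<in>(UNIV::'n set). ?K i)"
    by (intro sum.cong cball_integral_square_eq) simp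
  finally have "real CARD('n) * ?K i
      = real CARD('n) * (r\<^sup>2 / (real CARD('n) + 2) * measure lborel (cball (0::real^'n) r))"
    using cball_integral_norm_sq[OF assms, where 'a="real^'n"] by (simp add: ac_simps)
  then show ?thesis
    unfolding mult_cancel_left by simp
qed

text \<open>Expanded into monomials, the mixed terms integrate to 0 and the squares share one common
  integral, which leaves the sum of the diagonal entries of \<open>B\<close> as a factor.\<close>

lemma cball_integral_quadratic_form:
  fixes B :: "real^'n^'n"
  assumes "r > 0"
  shows "(LINT y:cball 0 r|lborel. y \<bullet> (B *v y))
    = trace B * r\<^sup>2 / (real CARD('n) + 2) * measure lborel (cball (0::real^'n) r)"
proof -
  let ?K = "\<lambda>i j. LINT y:cball (0::real^'n) r|lborel. y $ i * y $ j"
  have "(LINT y:cball 0 r|lborel. y \<bullet> (B *v y))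
      = (LINT y:cball 0 r|lborel. \<Sum>i\<in>UNIV. \<Sum>j\<in>UNIV. B $ i $ j * (y $ i * y $ j))"
    by (simp add: inner_vec_def matrix_vector_mult_def sum_distrib_left algebra_simps)
  also have "\<dots> = (\<Sum>i\<in>UNIV. \<Sum>j\<in>UNIV. LINT y:cball 0 r|lborel. B $ i $ j * (y $ i * y $ j))"
    unfolding set_lebesgue_integral_def scaleR_sum_right
    by (subst Bochner_Integration.integral_sum Bochner_Integration.integral_sum,
      intro Bochner_Integration.integrable_sum set_integrable_cball[unfolded set_integrable_def] continuous_intros)+
      (rule refl)
  also have "\<dots> = (\<Sum>i\<in>UNIV. \<Sum>j\<in>UNIV. B $ i $ j * ?K i j)"
    by simp
  also have "\<dots> = (\<Sum>i\<in>UNIV. \<Sum>j\<in>UNIV. if j = i then B $ i $ i * ?K i i else 0)"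
    by (intro sum.cong) (auto simp: cball_integral_product_offdiag)
  also have "\<dots> = (\<Sum>i\<in>UNIV. B $ i $ i * (r\<^sup>2 / (real CARD('n) + 2) * measure lborel (cball (0::real^'n) r)))"
    using cball_integral_square[OF assms, where 'n='n] by (simp add: power2_eq_square[of "_ $ _"])
  finally show ?thesis
    by (simp only: sum_distrib_right[symmetric] trace_def[symmetric]) simp
qed

subsection \<open>Asymptotics of the averages\<close>

lemma convex_paraboloid_expansion:
  fixes P :: "real^'n \<Rightarrow> real"
  assumes "convex_paraboloid P"
  obtains g H where "transpose H = H" "\<And>v. 0 \<le> v \<bullet> (H *v v)" "\<And>x. hessian P x = H"
    "\<And>x z. P (x + z) = P x + g x \<bullet> z + z \<bullet> (H *v z) / 2"
proof -
  obtain c b Q where P: "\<And>y. P y = c + b \<bullet> y + y \<bullet> (Q *v y)"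
    using assms by (auto simp: convex_paraboloid_def paraboloid_def)
  have conv: "convex_on UNIV P"
    using assms by (simp add: convex_paraboloid_def)
  define H where "H = Q + transpose Q"
  define g where "g x = b + H *v x" for x
  have tQ: "(transpose Q *v x) \<bullet> z = x \<bullet> (Q *v z)" for x z
    by (metis dot_lmul_matrix transpose_matrix_vector)
  have symH: "transpose H = H"
    by (simp add: H_def vec_eq_iff transpose_def add.commute)
  have Hz: "z \<bullet> (H *v z) = 2 * (z \<bullet> (Q *v z))" for z
    using tQ[of z z] by (simp add: H_def matrix_vector_mult_add_rdistrib inner_add_right inner_commute)
  have expansion: "P (x + z) = P x + g x \<bullet> z + z \<bullet> (H *v z) / 2" for x z
    unfolding Hz unfolding g_def H_def
    by (simp add: P matrix_vector_mult_add_rdistrib matrix_vector_right_distrib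
        inner_add_left inner_add_right dot_lmul_matrix inner_commute[of "Q *v x" z])
  have psd: "0 \<le> v \<bullet> (H *v v)" for v
  proof -
    \<comment> \<open>Midpoint convexity between \<open>v\<close> and \<open>- v\<close>: the linear
      terms cancel in \<open>P v + P (- v)\<close>, and the excess over \<open>2 * P 0\<close> is
      exactly \<open>v \<bullet> (H *v v)\<close>.\<close>
    have "P ((1 - 1/2) *\<^sub>R v + (1/2) *\<^sub>R (- v)) \<le> (1 - 1/2) * P v + (1/2) * P (- v)"
      using conv by (intro convex_onD) auto
    then have "2 * P 0 \<le> P v + P (- v)"
      by simp
    then show ?thesis
      using expansion[of 0 v] expansion[of 0 "- v"]
      by (simp add: Hz linear_neg[OF matrix_vector_mul_linear, of Q])
  qed
  have deriv: "(P has_derivative (\<lambda>h. g x \<bullet> h)) (at x)" for x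
  proof -
    have "((\<lambda>y. c + b \<bullet> y + y \<bullet> (Q *v y)) has_derivative (\<lambda>h. b \<bullet> h + (x \<bullet> (Q *v h) + h \<bullet> (Q *v x)))) (at x)"
      by (auto intro!: derivative_eq_intros bounded_linear.has_derivative[OF matrix_vector_mul_bounded_linear])
    moreover have "(\<lambda>h. b \<bullet> h + (x \<bullet> (Q *v h) + h \<bullet> (Q *v x))) = (\<lambda>h. g x \<bullet> h)"
      by (rule ext) (simp add: g_def H_def matrix_vector_mult_add_rdistrib inner_add_left
          dot_lmul_matrix inner_commute[of "Q *v x"])
    moreover have "P = (\<lambda>y. c + b \<bullet> y + y \<bullet> (Q *v y))"
      using P by auto
    ultimately show ?thesis by simp
  qed
  have "hessian P x = H" for x
  proof -
    have "((\<lambda>y. g y \<bullet> axis j 1) has_derivative (\<lambda>h. (H *v h) \<bullet> axis j 1)) (at x)" for j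
      unfolding g_def
      by (auto intro!: derivative_eq_intros bounded_linear.has_derivative[OF matrix_vector_mul_bounded_linear])
    then have "frechet_derivative (\<lambda>y. g y \<bullet> axis j 1) (at x) = (\<lambda>h. (H *v h) \<bullet> axis j 1)" for j
      by (rule frechet_derivative_at[symmetric])
    moreover have "frechet_derivative P (at y) = (\<lambda>h. g y \<bullet> h)" for y
      by (rule frechet_derivative_at[OF deriv, symmetric])
    \<comment> \<open>The entry at \<open>i\<close>, \<open>j\<close> differentiates the
      \<open>j\<close>-th partial derivative in direction \<open>i\<close> and so yields
      \<open>H $ j $ i\<close>; symmetry of \<open>H\<close> removes the transposition.\<close>
    ultimately have "hessian P x = transpose H"
      by (simp add: hessian_def vec_eq_iff transpose_def inner_axis matrix_vector_mult_basis column_def)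
    then show ?thesis by (simp add: symH)
  qed
  with symH psd expansion show thesis by (intro that)
qed

lemma ball_average_expansion:
  fixes P :: "real^'n \<Rightarrow> real"
  assumes P: "\<And>z. P (x + z) = P x + g \<bullet> z + z \<bullet> (H *v z) / 2" and "\<epsilon> > 0"
  shows "ball_average P x A \<epsilon>
    = P x + trace (transpose A ** H ** A) / (2 * (real CARD('n) + 2)) * \<epsilon>\<^sup>2"
proof -
  let ?B = "transpose A ** H ** A" and ?V = "measure lborel (cball (0::real^'n) \<epsilon>)"
  have lin: "g \<bullet> (A *v y) = (transpose A *v g) \<bullet> y" for y
    by (metis dot_lmul_matrix transpose_matrix_vector)
  have int: "set_integrable lborel (cball (0::real^'n) \<epsilon>) f" if "continuous_on UNIV f" for f :: "real^'n \<Rightarrow> real"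
    using that by (rule set_integrable_cball)
  have "(LINT y:cball 0 \<epsilon>|lborel. P (x + A *v y))
      = (LINT y:cball 0 \<epsilon>|lborel. P x + (transpose A *v g) \<bullet> y + y \<bullet> (?B *v y) / 2)"
    by (simp only: P lin quadratic_form_congruence)
  also have "\<dots> = (LINT y:cball (0::real^'n) \<epsilon>|lborel. P x)
      + (LINT y:cball 0 \<epsilon>|lborel. (transpose A *v g) \<bullet> y) + (LINT y:cball 0 \<epsilon>|lborel. y \<bullet> (?B *v y)) / 2"
  proof -
    have "set_integrable lborel (cball (0::real^'n) \<epsilon>) (\<lambda>y. P x)"
      "set_integrable lborel (cball 0 \<epsilon>) (\<lambda>y. (transpose A *v g) \<bullet> y)"
      "set_integrable lborel (cball 0 \<epsilon>) (\<lambda>y. y \<bullet> (?B *v y) / 2)"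
      by (intro int continuous_intros matrix_vector_mult_linear_continuous_on; simp)+
    then show ?thesis
      by (simp only: set_integral_add set_integral_divide_zero)
  qed
  also have "\<dots> = P x * ?V + trace ?B * \<epsilon>\<^sup>2 / (real CARD('n) + 2) * ?V / 2"
    unfolding cball_integral_quadratic_form[OF \<open>\<epsilon> > 0\<close>] cball_integral_linear
    by (simp add: set_lebesgue_integral_def)
  also have "\<dots> = ?V * (P x + trace ?B / (2 * (real CARD('n) + 2)) * \<epsilon>\<^sup>2)"
    by (simp add: field_simps)
  finally show ?thesis
    using content_cball_pos[OF \<open>\<epsilon> > 0\<close>, of "0::real^'n"] by (simp add: ball_average_def)
qed

lemma eventually_ellipsoid_subset:
  fixes A :: "real^'n^'n"
  assumes "open \<Omega>" "x \<in> \<Omega>" "invertible A"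
  shows "\<forall>\<^sub>F \<epsilon> in at_right 0. ellipsoid A x \<epsilon> \<subseteq> \<Omega>"
proof -
  obtain r where r: "r > 0" "ball x r \<subseteq> \<Omega>"
    using assms by (auto simp: open_contains_ball)
  \<comment> \<open>\<open>K\<close> bounds the operator norm of \<open>A\<close>, so the ellipsoid
    lies in the closed ball of radius \<open>\<epsilon> * K\<close>. The threshold on
    \<open>\<epsilon>\<close> thus depends on \<open>A\<close>.\<close>
  obtain K where K: "K > 0" "\<And>z. norm (A *v z) \<le> norm z * K"
    using bounded_linear.pos_bounded[OF matrix_vector_mul_bounded_linear[of A]] by blast
  have "\<forall>\<^sub>F \<epsilon> in at_right 0. \<epsilon> < r / K"
    using r K by (intro order_tendstoD(2)[OF tendsto_ident_at]) auto
  then show ?thesis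
  proof eventually_elim
    case (elim \<epsilon>)
    show ?case
    proof
      fix y assume "y \<in> ellipsoid A x \<epsilon>"
      then have "norm (matrix_inv A *v (y - x)) \<le> \<epsilon>"
        by (simp add: ellipsoid_def)
      moreover have "A *v (matrix_inv A *v (y - x)) = y - x"
      proof -
        have "A ** matrix_inv A = mat 1 \<and> matrix_inv A ** A = mat 1"
          using assms(3) unfolding matrix_inv_def invertible_def by (rule someI_ex)
        then show ?thesis
          by (simp add: matrix_vector_mul_assoc)
      qed
      ultimately have "norm (y - x) \<le> \<epsilon> * K"
        using K by (metis mult_right_mono less_imp_le order_trans)
      also have "\<dots> < r"
        using elim K by (simp add: field_simps)
      finally show "y \<in> \<Omega>"
        using r by (auto simp: dist_norm norm_minus_commute)
    qed
  qed
qed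

text \<open>The two bounds are of different nature: the lower one holds for all admissible matrices
  at once, whereas the upper one fixes a nearly optimal matrix first and then lets
  \<open>\<epsilon>\<close> shrink until that matrix is admissible.\<close>

lemma inf_average_asymptotics:
  fixes P :: "real^'n \<Rightarrow> real"
  assumes "open \<Omega>" "x \<in> \<Omega>" "convex_paraboloid P"
  shows "((\<lambda>\<epsilon>. (inf_average \<Omega> P x \<epsilon> - P x) / \<epsilon>\<^sup>2) \<longlongrightarrow>
    real CARD('n) / (2 * (real CARD('n) + 2)) * root CARD('n) (det (hessian P x))) (at_right 0)"
proof -
  obtain g H where H: "transpose H = H" "\<And>v. 0 \<le> v \<bullet> (H *v v)" "\<And>x. hessian P x = H"
    and P: "\<And>x z. P (x + z) = P x + g x \<bullet> z + z \<bullet> (H *v z) / 2"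
    by (rule convex_paraboloid_expansion[OF assms(3)], rule that)
  define k where "k = 2 * (real CARD('n) + 2)"
  define m where "m = real CARD('n) * root CARD('n) (det H)"
  define S where "S \<epsilon> = {A. symmetric_pos_def A \<and> det A = 1 \<and> ellipsoid A x \<epsilon> \<subseteq> \<Omega>}" for \<epsilon>
  have k: "k > 0"
    by (simp add: k_def)
  have avg: "ball_average P x A \<epsilon> = P x + trace (transpose A ** H ** A) / k * \<epsilon>\<^sup>2" if "\<epsilon> > 0" for A \<epsilon>
    unfolding k_def using that by (rule ball_average_expansion[OF P])
  \<comment> \<open>This bound is uniform in \<open>A\<close>; it gives the lower estimate of the
    limit and also the boundedness from below that the real infimum requires.\<close>
  have lb: "P x + m / k * \<epsilon>\<^sup>2 \<le> ball_average P x A \<epsilon>" if "\<epsilon> > 0" "A \<in> S \<epsilon>" for A \<epsilon>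
    unfolding avg[OF that(1)] m_def using that(2) k
    by (auto simp: S_def intro!: mult_right_mono divide_right_mono root_det_le_trace_congruence H)
  have inf: "inf_average \<Omega> P x \<epsilon> = (INF A\<in>S \<epsilon>. ball_average P x A \<epsilon>)" for \<epsilon>
    by (simp add: inf_average_def S_def)
  have pos: "\<forall>\<^sub>F \<epsilon> in at_right (0::real). \<epsilon> > 0"
    by (simp add: eventually_at_right_less)
  have admissible: "\<forall>\<^sub>F \<epsilon> in at_right 0. A \<in> S \<epsilon>" if "symmetric_pos_def A" "det A = 1" for A
  proof -
    have "invertible A"
      using that by (simp add: invertible_det_nz)
    from eventually_ellipsoid_subset[OF assms(1,2) this] show ?thesis
      by eventually_elim (simp add: S_def that)
  qed
  have upper: "\<forall>\<^sub>F \<epsilon> in at_right 0. (inf_average \<Omega> P x \<epsilon> - P x) / \<epsilon>\<^sup>2 \<le> trace (transpose A ** H ** A) / k"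
    if A: "symmetric_pos_def A" "det A = 1" for A
    using pos admissible[OF A]
  proof eventually_elim
    case (elim \<epsilon>)
    have "bdd_below ((\<lambda>A. ball_average P x A \<epsilon>) ` S \<epsilon>)"
      using lb elim by (intro bdd_belowI2)
    then have "inf_average \<Omega> P x \<epsilon> \<le> ball_average P x A \<epsilon>"
      unfolding inf using elim by (intro cINF_lower)
    then show ?case
      using elim by (simp add: avg divide_le_eq)
  qed
  \<comment> \<open>The identity matrix witnesses that the set of admissible matrices is eventually
    nonempty, without which the real infimum would not inherit the lower bound.\<close>
  have "symmetric_pos_def (mat 1 :: real^'n^'n)"
    by (simp add: symmetric_pos_def_def)
  then have "\<forall>\<^sub>F \<epsilon> in at_right 0. mat 1 \<in> S \<epsilon>"
    by (intro admissible) auto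
  with pos have lower: "\<forall>\<^sub>F \<epsilon> in at_right 0. m / k \<le> (inf_average \<Omega> P x \<epsilon> - P x) / \<epsilon>\<^sup>2"
  proof eventually_elim
    case (elim \<epsilon>)
    have "P x + m / k * \<epsilon>\<^sup>2 \<le> inf_average \<Omega> P x \<epsilon>"
      unfolding inf using lb elim by (intro cINF_greatest) auto
    then show ?case
      using elim by (simp add: le_divide_eq)
  qed
  have "((\<lambda>\<epsilon>. (inf_average \<Omega> P x \<epsilon> - P x) / \<epsilon>\<^sup>2) \<longlongrightarrow> m / k) (at_right 0)"
  proof (rule order_tendstoI)
    fix a assume "a < m / k"
    with lower show "\<forall>\<^sub>F \<epsilon> in at_right 0. a < (inf_average \<Omega> P x \<epsilon> - P x) / \<epsilon>\<^sup>2"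
      by (auto elim: eventually_mono)
  next
    fix a assume "m / k < a"
    \<comment> \<open>The slack \<open>a * k - m\<close> is the tolerance for the trace that makes
      the coefficient \<open>trace (transpose A ** H ** A) / k\<close> fall strictly below
      \<open>a\<close>.\<close>
    then have "a * k - m > 0"
      using k by (simp add: field_simps)
    then obtain A where A: "symmetric_pos_def A" "det A = 1" "trace (transpose A ** H ** A) < m + (a * k - m)"
      unfolding m_def using exists_trace_congruence_less[OF H(1,2)] by blast
    then have "trace (transpose A ** H ** A) / k < a"
      using k by (simp add: field_simps)
    with upper[OF A(1,2)] show "\<forall>\<^sub>F \<epsilon> in at_right 0. (inf_average \<Omega> P x \<epsilon> - P x) / \<epsilon>\<^sup>2 < a"
      by (auto elim: eventually_mono)
  qed
  then show ?thesis
    by (simp add: m_def k_def H(3))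
qed

text \<open>Dividing by \<open>\<epsilon>\<^sup>2\<close> inside the maximum turns each quotient
  into the positive part of a convergent expression. Its limit is \<open>max 0 (b - a)\<close> or
  \<open>max 0 (a - b)\<close>, and by uniqueness of limits the condition says that this number is
  0.\<close>

lemma
  fixes h :: "real \<Rightarrow> real"
  assumes h: "((\<lambda>\<epsilon>. (h \<epsilon> - c) / \<epsilon>\<^sup>2) \<longlongrightarrow> a) (at_right 0)"
  shows le_plus_o_sq_iff: "le_plus_o_sq c (\<lambda>\<epsilon>. h \<epsilon> - b * \<epsilon>\<^sup>2) \<longleftrightarrow> b \<le> a"
    and ge_plus_o_sq_iff: "ge_plus_o_sq c (\<lambda>\<epsilon>. h \<epsilon> - b * \<epsilon>\<^sup>2) \<longleftrightarrow> a \<le> b"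
proof -
  have ev: "\<forall>\<^sub>F \<epsilon> in at_right (0::real). \<epsilon> > 0"
    by (simp add: eventually_at_right_less)
  have le: "((\<lambda>\<epsilon>. max 0 (c - (h \<epsilon> - b * \<epsilon>\<^sup>2)) / \<epsilon>\<^sup>2) \<longlongrightarrow> max 0 (b - a)) (at_right 0)"
  proof (rule Lim_transform_eventually)
    show "((\<lambda>\<epsilon>. max 0 (b - (h \<epsilon> - c) / \<epsilon>\<^sup>2)) \<longlongrightarrow> max 0 (b - a)) (at_right 0)"
      by (intro tendsto_intros h)
    show "\<forall>\<^sub>F \<epsilon> in at_right 0. max 0 (b - (h \<epsilon> - c) / \<epsilon>\<^sup>2) = max 0 (c - (h \<epsilon> - b * \<epsilon>\<^sup>2)) / \<epsilon>\<^sup>2"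
      using ev by eventually_elim (simp add: max_divide_distrib_right field_simps)
  qed
  have ge: "((\<lambda>\<epsilon>. max 0 (- (c - (h \<epsilon> - b * \<epsilon>\<^sup>2))) / \<epsilon>\<^sup>2) \<longlongrightarrow> max 0 (a - b)) (at_right 0)"
  proof (rule Lim_transform_eventually)
    show "((\<lambda>\<epsilon>. max 0 ((h \<epsilon> - c) / \<epsilon>\<^sup>2 - b)) \<longlongrightarrow> max 0 (a - b)) (at_right 0)"
      by (intro tendsto_intros h)
    show "\<forall>\<^sub>F \<epsilon> in at_right 0. max 0 ((h \<epsilon> - c) / \<epsilon>\<^sup>2 - b) = max 0 (- (c - (h \<epsilon> - b * \<epsilon>\<^sup>2))) / \<epsilon>\<^sup>2"
      using ev by eventually_elim (simp add: max_divide_distrib_right field_simps)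
  qed
  have iff0: "(F \<longlongrightarrow> 0) (at_right 0) \<longleftrightarrow> d \<le> 0" if "(F \<longlongrightarrow> max 0 d) (at_right 0)"
    for F :: "real \<Rightarrow> real" and d
  proof
    assume "(F \<longlongrightarrow> 0) (at_right 0)"
    with that have "max 0 d = 0"
      by (rule tendsto_unique[OF trivial_limit_at_right_real])
    then show "d \<le> 0" by simp
  next
    assume "d \<le> 0"
    with that show "(F \<longlongrightarrow> 0) (at_right 0)"
      by (simp add: max_absorb1)
  qed
  show "le_plus_o_sq c (\<lambda>\<epsilon>. h \<epsilon> - b * \<epsilon>\<^sup>2) \<longleftrightarrow> b \<le> a"
    unfolding le_plus_o_sq_def iff0[OF le] by simp
  show "ge_plus_o_sq c (\<lambda>\<epsilon>. h \<epsilon> - b * \<epsilon>\<^sup>2) \<longleftrightarrow> a \<le> b"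
    unfolding ge_plus_o_sq_def iff0[OF ge] by simp
qed

theorem theorem1p4:
  fixes \<Omega> :: "(real^'n) set" and f u :: "real^'n \<Rightarrow> real"
  assumes "open \<Omega>" and "convex \<Omega>" and "\<Omega> \<noteq> {}"
    and "continuous_on \<Omega> f" and "\<forall>x\<in>\<Omega>. 0 \<le> f x"
    and "continuous_on \<Omega> u" and "convex_on \<Omega> u"
  shows "(MA_viscosity_subsolution \<Omega> f u \<longleftrightarrow>
      (\<forall>x\<in>\<Omega>. \<forall>P. convex_paraboloid P \<and> touches_above P u x \<longrightarrow>
        le_plus_o_sq (P x) (\<lambda>\<epsilon>. inf_average \<Omega> P x \<epsilon>
          - real CARD('n) / (2 * (real CARD('n) + 2)) * root CARD('n) (f x) * \<epsilon>\<^sup>2))) \<and>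
    (MA_viscosity_supersolution \<Omega> f u \<longleftrightarrow>
      (\<forall>x\<in>\<Omega>. \<forall>P. convex_paraboloid P \<and> touches_below P u x \<longrightarrow>
        ge_plus_o_sq (P x) (\<lambda>\<epsilon>. inf_average \<Omega> P x \<epsilon>
          - real CARD('n) / (2 * (real CARD('n) + 2)) * root CARD('n) (f x) * \<epsilon>\<^sup>2)))"
proof -
  let ?k = "real CARD('n) / (2 * (real CARD('n) + 2))"
  have k: "?k > 0"
    by simp
  \<comment> \<open>The limit of the averages and the coefficient of the correction term share the
    positive factor \<open>?k\<close>. Cancelling it leaves a comparison of two roots, and
    \<open>root\<close> is strictly increasing.\<close>
  have "le_plus_o_sq (P x) (\<lambda>\<epsilon>. inf_average \<Omega> P x \<epsilon> - ?k * root CARD('n) (f x) * \<epsilon>\<^sup>2)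
      \<longleftrightarrow> f x \<le> det (hessian P x)"
    "ge_plus_o_sq (P x) (\<lambda>\<epsilon>. inf_average \<Omega> P x \<epsilon> - ?k * root CARD('n) (f x) * \<epsilon>\<^sup>2)
      \<longleftrightarrow> det (hessian P x) \<le> f x"
    if "x \<in> \<Omega>" "convex_paraboloid P" for x P
    unfolding le_plus_o_sq_iff[OF inf_average_asymptotics[OF assms(1) that]]
      ge_plus_o_sq_iff[OF inf_average_asymptotics[OF assms(1) that]]
      mult_le_cancel_left_pos[OF k]
    by (simp_all add: real_root_le_iff)
  then show ?thesis
    using assms(7) unfolding MA_viscosity_subsolution_def MA_viscosity_supersolution_def
    by blast
qed

end
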